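(* Let $r$ be a nonnegative integer. For all integers $k,n\ge 0$, $$\sum_{j=0}^{k}\binom{k}{j}(-1)^{j}(j+r)_{n,\lambda}=(-1)^{k}k!\sum_{l=k}^{n}\binom{n}{l}S_{2,\lambda}(l,k)(r)_{n-l,\lambda}=(-1)^{k}\Delta^{k}(r)_{n,\lambda},$$ where $\Delta^k(r)_{n,\lambda}$ denotes $\Delta^k$ applied to $x\mapsto(x)_{n,\lambda}$ and evaluated at $x=r$ (an empty sum is $0$).
   Context: Let $\lambda\in\mathbb{R}$. $(x)_{0,\lambda}=1$, $(x)_{n,\lambda}=x(x-\lambda)\cdots(x-(n-1)\lambda)$ for $n\ge1$; $(x)_0=1$, $(x)_n=x(x-1)\cdots(x-n+1)$. The degenerate Stirling numbers of the second kind $S_{2,\lambda}(n,k)$ are defined by $(x)_{n,\lambda}=\sum_{k=0}^{n}S_{2,\lambda}(n,k)(x)_k$ for $n\ge0$ (and $S_{2,\lambda}(n,k)=0$ for $k>n$). $\Delta f(x)=f(x+1)-f(x)$, so $\Delta^k f(x)=\sum_{j=0}^k\binom{k}{j}(-1)^{k-j}f(x+j)$. *)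

theory Defs
  imports Complex_Main
begin

definition ffact :: "real \<Rightarrow> nat \<Rightarrow> real" where
  "ffact x n = (\<Prod>i<n. x - real i)"

definition deg_ffact :: "real \<Rightarrow> real \<Rightarrow> nat \<Rightarrow> real" where
  "deg_ffact lam x n = (\<Prod>i<n. x - real i * lam)"

definition is_deg_Stirling2_row :: "real \<Rightarrow> nat \<Rightarrow> (nat \<Rightarrow> real) \<Rightarrow> bool" where
  "is_deg_Stirling2_row lam n c \<longleftrightarrow>
     (\<forall>x. deg_ffact lam x n = (\<Sum>k=0..n. c k * ffact x k)) \<and> (\<forall>k>n. c k = 0)"

text \<open>The coefficients are well defined, see \<open>ex1_deg_Stirling2_row\<close> below.\<close>

definition deg_Stirling2 :: "real \<Rightarrow> nat \<Rightarrow> nat \<Rightarrow> real" where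
  "deg_Stirling2 lam n = (THE c. is_deg_Stirling2_row lam n c)"

definition fwd_diff :: "(real \<Rightarrow> real) \<Rightarrow> real \<Rightarrow> real" where
  "fwd_diff f = (\<lambda>x. f (x + 1) - f x)"

lemma ffact_Suc: "ffact x (Suc n) = ffact x n * (x - real n)"
  by (simp add: ffact_def)

lemma deg_ffact_Suc: "deg_ffact lam x (Suc n) = deg_ffact lam x n * (x - real n * lam)"
  by (simp add: deg_ffact_def)

lemma ffact_nat_eq_0: "m < k \<Longrightarrow> ffact (real m) k = 0"
  by (auto simp: ffact_def)

lemma ffact_nat_self_nonzero: "ffact (real m) m \<noteq> 0"
  by (auto simp: ffact_def)

lemma ffact_coeffs_eq_0:
  assumes "\<And>x. (\<Sum>k=0..n. d k * ffact x k) = 0" and "m \<le> n"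
  shows "d m = 0"
  using assms(2)
proof (induction m rule: less_induct)
  case (less m)
  have "(\<Sum>k=0..n. d k * ffact (real m) k) = (\<Sum>k\<in>{m}. d k * ffact (real m) k)"
  proof (rule sum.mono_neutral_right)
    show "\<forall>i\<in>{0..n} - {m}. d i * ffact (real m) i = 0"
    proof
      fix i assume "i \<in> {0..n} - {m}"
      then show "d i * ffact (real m) i = 0"
        using less ffact_nat_eq_0 [of m i] by (cases "i < m") auto
    qed
  qed (use less in auto)
  then show ?case
    using assms(1)[of "real m"] ffact_nat_self_nonzero by simp
qed

lemma ex_deg_Stirling2_row: "\<exists>c. is_deg_Stirling2_row lam n c"
proof (induction n)
  case 0
  show ?case
    by (rule exI[of _ "\<lambda>k. if k = 0 then 1 else 0"])
       (simp add: is_deg_Stirling2_row_def deg_ffact_def ffact_def)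
next
  case (Suc n)
  then obtain c where c: "\<And>x. deg_ffact lam x n = (\<Sum>k=0..n. c k * ffact x k)"
    and z: "\<And>k. k > n \<Longrightarrow> c k = 0"
    by (auto simp: is_deg_Stirling2_row_def)
  define e where "e k = c k * (real k - real n * lam)" for k
  define c' where "c' k = (case k of 0 \<Rightarrow> 0 | Suc j \<Rightarrow> c j) + e k" for k
  have "deg_ffact lam x (Suc n) = (\<Sum>k=0..Suc n. c' k * ffact x k)" for x
  proof -
    have "deg_ffact lam x (Suc n) = (\<Sum>k=0..n. c k * ffact x (Suc k) + e k * ffact x k)"
      unfolding deg_ffact_Suc c sum_distrib_right
      by (rule sum.cong) (auto simp: ffact_Suc e_def algebra_simps)
    also have "\<dots> = (\<Sum>k=0..n. c k * ffact x (Suc k)) + (\<Sum>k=0..n. e k * ffact x k)"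
      by (rule sum.distrib)
    also have "(\<Sum>k=0..n. c k * ffact x (Suc k)) =
        (\<Sum>k=0..Suc n. (case k of 0 \<Rightarrow> 0 | Suc j \<Rightarrow> c j) * ffact x k)"
      by (simp only: sum.atLeast0_atMost_Suc_shift) simp
    also have "(\<Sum>k=0..n. e k * ffact x k) = (\<Sum>k=0..Suc n. e k * ffact x k)"
      by (simp add: e_def z)
    finally show ?thesis
      by (simp only: c'_def distrib_right sum.distrib)
  qed
  moreover have "c' k = 0" if "k > Suc n" for k
    using that by (cases k) (auto simp: c'_def e_def z)
  ultimately show ?case
    by (auto simp: is_deg_Stirling2_row_def)
qed

lemma ex1_deg_Stirling2_row: "\<exists>!c. is_deg_Stirling2_row lam n c"
proof (rule ex_ex1I[OF ex_deg_Stirling2_row])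
  fix c d assume c: "is_deg_Stirling2_row lam n c" and d: "is_deg_Stirling2_row lam n d"
  have "(\<Sum>k=0..n. (c k - d k) * ffact x k) = 0" for x
    using c d by (simp add: is_deg_Stirling2_row_def left_diff_distrib sum_subtractf)
  then have "c k - d k = 0" if "k \<le> n" for k
    using ffact_coeffs_eq_0[where n = n and d = "\<lambda>k. c k - d k"] that by blast
  moreover have "c k = d k" if "k > n" for k
    using c d that by (simp add: is_deg_Stirling2_row_def)
  ultimately show "c = d"
    by (metis eq_iff_diff_eq_0 ext not_le)
qed

lemma deg_Stirling2_row: "is_deg_Stirling2_row lam n (deg_Stirling2 lam n)"
  unfolding deg_Stirling2_def by (rule theI'[OF ex1_deg_Stirling2_row])

end

theory Submission
  imports Defs
begin

text \<open>
  The alternating sum is \<open>(-1)^k \<Delta>^k\<close> of \<open>x \<mapsto> (x)\<^bsub>n,\<lambda>\<^esub>\<close> at \<open>r\<close>, which is the same as \<open>(-1)^k \<Delta>^k\<close> of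
  \<open>x \<mapsto> (x + r)\<^bsub>n,\<lambda>\<^esub>\<close> at \<open>0\<close>. The degenerate Vandermonde identity expands the latter function in
  the \<open>(x)\<^bsub>l,\<lambda>\<^esub>\<close>; for \<open>\<lambda> = 0\<close> it is the binomial theorem, and otherwise \<open>(x)\<^bsub>n,\<lambda>\<^esub>\<close> is \<open>(-\<lambda>)^n\<close> times the
  rising factorial of \<open>-x/\<lambda>\<close>. By Newton's formula \<open>\<Delta>^k\<close> at \<open>0\<close> reads off \<open>k!\<close> times the coefficient
  of \<open>(x)\<^sub>k\<close>, which for \<open>(x)\<^bsub>l,\<lambda>\<^esub>\<close> is \<open>S\<^bsub>2,\<lambda>\<^esub>(l,k)\<close>.
\<close>

lemma fwd_diff_funpow_sum:
  "(fwd_diff ^^ k) (\<lambda>x. \<Sum>i\<in>A. c i * g i x) = (\<lambda>x. \<Sum>i\<in>A. c i * (fwd_diff ^^ k) (g i) x)"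
  by (induction k) (simp_all add: fwd_diff_def fun_eq_iff sum_subtractf right_diff_distrib)

lemma fwd_diff_funpow_shift:
  "(fwd_diff ^^ k) (\<lambda>x. f (x + a)) = (\<lambda>x. (fwd_diff ^^ k) f (x + a))"
  by (induction k) (simp_all add: fwd_diff_def fun_eq_iff ac_simps)

lemma fwd_diff_funpow_eq_sum:
  "(fwd_diff ^^ k) f x = (\<Sum>j=0..k. real (k choose j) * (-1) ^ (k - j) * f (x + real j))"
proof (induction k arbitrary: x)
  case 0
  show ?case by simp
next
  case (Suc k)
  have "(fwd_diff ^^ Suc k) f x = (fwd_diff ^^ k) f (x + 1) - (fwd_diff ^^ k) f x"
    by (simp add: fwd_diff_def)
  also have "(fwd_diff ^^ k) f (x + 1) =
      (\<Sum>j=0..k. real (k choose j) * (-1) ^ (k - j) * f (x + real (Suc j)))"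
    by (simp add: Suc.IH add.assoc)
  also have "(fwd_diff ^^ k) f x =
      - (\<Sum>j=0..Suc k. real (k choose j) * (-1) ^ (Suc k - j) * f (x + real j))"
    by (simp add: Suc.IH Suc_diff_le binomial_eq_0 flip: sum_negf)
  also have "(\<Sum>j=0..k. real (k choose j) * (-1) ^ (k - j) * f (x + real (Suc j))) - \<dots> =
      (\<Sum>j=0..Suc k. real (Suc k choose j) * (-1) ^ (Suc k - j) * f (x + real j))"
    unfolding sum.atLeast0_atMost_Suc_shift by (simp add: sum.distrib algebra_simps)
  finally show ?case .
qed

lemma fwd_diff_gbinomial_Suc: "fwd_diff (\<lambda>x. x gchoose Suc m) = (\<lambda>x. x gchoose m)"
  by (simp add: fwd_diff_def gbinomial_Suc_Suc)

lemma fwd_diff_funpow_gbinomial: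
  "(fwd_diff ^^ k) (\<lambda>x. x gchoose m) = (\<lambda>x. if k \<le> m then x gchoose (m - k) else 0)"
proof (induction k)
  case 0
  show ?case by simp
next
  case (Suc k)
  have "fwd_diff (\<lambda>x. if k \<le> m then x gchoose (m - k) else 0) =
      (\<lambda>x. if Suc k \<le> m then x gchoose (m - Suc k) else 0)"
  proof (cases "Suc k \<le> m")
    case True
    then have "m - k = Suc (m - Suc k)"
      by simp
    with True show ?thesis
      by (simp add: fwd_diff_gbinomial_Suc)
  next
    case False
    then show ?thesis
      by (simp add: fwd_diff_def fun_eq_iff)
  qed
  then show ?case
    by (simp add: Suc.IH)
qed

lemma ffact_eq_fact_mult_gbinomial: "ffact x n = fact n * (x gchoose n)"
  by (simp add: ffact_def gbinomial_mult_fact lessThan_atLeast0)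

lemma fwd_diff_funpow_ffact_0:
  "(fwd_diff ^^ k) (\<lambda>x. ffact x m) 0 = (if m = k then fact k else 0)"
proof -
  have "(fwd_diff ^^ k) (\<lambda>x. ffact x m) 0 = fact m * (fwd_diff ^^ k) (\<lambda>x. x gchoose m) 0"
    using fwd_diff_funpow_sum[of k "\<lambda>_. fact m" "\<lambda>_ x. x gchoose m" "{m}"]
    by (simp add: ffact_eq_fact_mult_gbinomial)
  then show ?thesis
    by (auto simp: fwd_diff_funpow_gbinomial gbinomial_0_left)
qed

lemma fwd_diff_funpow_ffact_sum_0:
  "(fwd_diff ^^ k) (\<lambda>x. \<Sum>m=0..n. c m * ffact x m) 0 = (if k \<le> n then fact k * c k else 0)"
  unfolding fwd_diff_funpow_sum fwd_diff_funpow_ffact_0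
  by (simp add: if_distrib sum.delta cong: if_cong)

lemma deg_ffact_eq_sum_deg_Stirling2:
  "deg_ffact lam x n = (\<Sum>k=0..n. deg_Stirling2 lam n k * ffact x k)"
  using deg_Stirling2_row[of lam n] by (simp add: is_deg_Stirling2_row_def)

lemma deg_Stirling2_eq_0: "n < k \<Longrightarrow> deg_Stirling2 lam n k = 0"
  using deg_Stirling2_row[of lam n] by (simp add: is_deg_Stirling2_row_def)

lemma fwd_diff_funpow_deg_ffact_0:
  "(fwd_diff ^^ k) (\<lambda>x. deg_ffact lam x n) 0 = fact k * deg_Stirling2 lam n k"
  by (simp add: deg_ffact_eq_sum_deg_Stirling2 fwd_diff_funpow_ffact_sum_0 deg_Stirling2_eq_0)

lemma deg_ffact_0_left: "deg_ffact 0 x n = x ^ n"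
  by (simp add: deg_ffact_def)

lemma deg_ffact_eq_pochhammer:
  assumes "lam \<noteq> 0"
  shows "deg_ffact lam x n = (- lam) ^ n * pochhammer (- x / lam) n"
proof -
  have "(- lam) ^ n * pochhammer (- x / lam) n = (\<Prod>i<n. - lam * (- x / lam + real i))"
    by (simp only: pochhammer_prod lessThan_atLeast0 prod.distrib prod_constant card_atLeastLessThan
        diff_zero)
  also have "\<dots> = deg_ffact lam x n"
    unfolding deg_ffact_def using assms by (intro prod.cong) (simp_all add: field_simps)
  finally show ?thesis ..
qed

lemma deg_ffact_add:
  "deg_ffact lam (x + y) n =
     (\<Sum>l=0..n. real (n choose l) * deg_ffact lam x l * deg_ffact lam y (n - l))"
proof (cases "lam = 0")
  case True
  then show ?thesis
    by (simp add: deg_ffact_0_left binomial_ring atMost_atLeast0)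
next
  case False
  have "deg_ffact lam (x + y) n = (- lam) ^ n * pochhammer (- x / lam + - y / lam) n"
    using False by (simp add: deg_ffact_eq_pochhammer diff_divide_distrib)
  also have "\<dots> = (\<Sum>l=0..n. (- lam) ^ n *
      (real (n choose l) * pochhammer (- x / lam) l * pochhammer (- y / lam) (n - l)))"
    by (simp only: pochhammer_binomial_sum sum_distrib_left atMost_atLeast0)
  also have "\<dots> = (\<Sum>l=0..n. real (n choose l) * deg_ffact lam x l * deg_ffact lam y (n - l))"
  proof (rule sum.cong)
    fix l assume "l \<in> {0..n}"
    then have "(- lam) ^ n = (- lam) ^ l * (- lam) ^ (n - l)"
      by (simp flip: power_add)
    then show "(- lam) ^ n *
        (real (n choose l) * pochhammer (- x / lam) l * pochhammer (- y / lam) (n - l)) =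
        real (n choose l) * deg_ffact lam x l * deg_ffact lam y (n - l)"
      by (simp only: deg_ffact_eq_pochhammer[OF False] mult_ac)
  qed simp
  finally show ?thesis .
qed

lemma fwd_diff_funpow_deg_ffact:
  "(fwd_diff ^^ k) (\<lambda>x. deg_ffact lam x n) a =
     fact k * (\<Sum>l=k..n. real (n choose l) * deg_Stirling2 lam l k * deg_ffact lam a (n - l))"
proof -
  have "(fwd_diff ^^ k) (\<lambda>x. deg_ffact lam x n) a =
      (fwd_diff ^^ k) (\<lambda>x. deg_ffact lam (x + a) n) 0"
    by (simp add: fwd_diff_funpow_shift[where f = "\<lambda>x. deg_ffact lam x n"])
  also have "(\<lambda>x. deg_ffact lam (x + a) n) =
      (\<lambda>x. \<Sum>l=0..n. (real (n choose l) * deg_ffact lam a (n - l)) * deg_ffact lam x l)"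
    by (simp add: deg_ffact_add mult_ac)
  also have "(fwd_diff ^^ k) \<dots> 0 =
      (\<Sum>l=0..n. (real (n choose l) * deg_ffact lam a (n - l)) * (fact k * deg_Stirling2 lam l k))"
    by (simp add: fwd_diff_funpow_sum fwd_diff_funpow_deg_ffact_0)
  also have "\<dots> =
      (\<Sum>l=k..n. (real (n choose l) * deg_ffact lam a (n - l)) * (fact k * deg_Stirling2 lam l k))"
    by (intro sum.mono_neutral_right) (auto simp: deg_Stirling2_eq_0)
  finally show ?thesis
    by (simp add: sum_distrib_left mult_ac)
qed

theorem theorem5:
  fixes lam :: real and r k n :: nat
  shows "(\<Sum>j=0..k. real (k choose j) * (-1) ^ j * deg_ffact lam (real j + real r) n)
           = (-1) ^ k * fact k *
             (\<Sum>l=k..n. real (n choose l) * deg_Stirling2 lam l k * deg_ffact lam (real r) (n - l))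
       \<and> (-1) ^ k * fact k *
             (\<Sum>l=k..n. real (n choose l) * deg_Stirling2 lam l k * deg_ffact lam (real r) (n - l))
           = (-1) ^ k * (fwd_diff ^^ k) (\<lambda>x. deg_ffact lam x n) (real r)"
proof -
  have "(\<Sum>j=0..k. real (k choose j) * (-1) ^ j * deg_ffact lam (real j + real r) n) =
      (-1) ^ k * (fwd_diff ^^ k) (\<lambda>x. deg_ffact lam x n) (real r)"
    unfolding fwd_diff_funpow_eq_sum sum_distrib_left
    by (intro sum.cong) (auto simp: minus_one_power_iff add.commute)
  then show ?thesis
    by (simp add: fwd_diff_funpow_deg_ffact mult.assoc)
qed

end
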